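(* Let $(\mathcal Q,d)$ be a Hadamard space, $Y$ a $\mathcal Q$-valued random variable and $o\in\mathcal Q$. Let $M:=\arg\min_{q\in\mathcal Q}\mathbb E[d(Y,q)-d(Y,o)]$ be the set of Fréchet medians of $Y$. Then: (i) $M$ is a geodesic segment (a closed and bounded set that is the image of a geodesic). (ii) If $M$ has more than one element and $\gamma_M$ is a unit-speed geodesic with image $M$, then $$\mathbb P(Y\in L(\gamma_M))=\mathbb P(Y\in R(\gamma_M))=\tfrac12\quad\text{and}\quad \mathbb P(Y\in\mathring\gamma_M)=0.$$
   Context: A Hadamard space is a complete metric space $(\mathcal Q,d)$ such that for all $y_0,y_1$ there is $m$ with $\frac12 d(y_0,q)^2+\frac12 d(y_1,q)^2-\frac14 d(y_0,y_1)^2\ge d(q,m)^2$ for all $q$ (complete CAT(0) space). A unit-speed geodesic is a map $\gamma:I_\gamma\to\mathcal Q$ on an interval $I_\gamma\subset\mathbb R$ with $d(\gamma(s),\gamma(t))=|s-t|$. For an interval $I$, $I^{\ominus}:=I\setminus\{\inf I\}$, $I^{\oplus}:=I\setminus\{\sup I\}$, $\mathring I:=I^{\ominus}\cap I^{\oplus}$; $\mathring\gamma:=\gamma(\mathring I_\gamma)$. For real functions, $g^{\oplus}$, $g^{\ominus}$ denote right and left derivatives. For $y\in\mathcal Q$ let $f_y(t):=d(y,\gamma(t))$. Then $L(\gamma):=\{y\in\mathcal Q:\ f_y^{\oplus}(t)=1\ \forall t\in I_\gamma^{\oplus}\}$ and $R(\gamma):=\{y\in\mathcal Q:\ f_y^{\ominus}(t)=-1\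 \forall t\in I_\gamma^{\ominus}\}$. *)

theory Defs
  imports "HOL-Probability.Probability"
begin

definition hadamard :: "('a::metric_space) set \<Rightarrow> bool" where
  "hadamard Q \<longleftrightarrow> Topological_Spaces.complete Q \<and>
     (\<forall>y0\<in>Q. \<forall>y1\<in>Q. \<exists>m\<in>Q. \<forall>q\<in>Q.
        (1/2) * (dist y0 q)\<^sup>2 + (1/2) * (dist y1 q)\<^sup>2 - (1/4) * (dist y0 y1)\<^sup>2 \<ge> (dist q m)\<^sup>2)"

definition unit_geodesic :: "(real \<Rightarrow> 'a::metric_space) \<Rightarrow> real set \<Rightarrow> bool" where
  "unit_geodesic \<gamma> I \<longleftrightarrow> is_interval I \<and> (\<forall>s\<in>I. \<forall>t\<in>I. dist (\<gamma> s) (\<gamma> t) = \<bar>s - t\<bar>)"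

definition int_oplus :: "real set \<Rightarrow> real set" where
  "int_oplus I = {t\<in>I. \<exists>s\<in>I. t < s}"

definition int_ominus :: "real set \<Rightarrow> real set" where
  "int_ominus I = {t\<in>I. \<exists>s\<in>I. s < t}"

definition int_open :: "real set \<Rightarrow> real set" where
  "int_open I = int_ominus I \<inter> int_oplus I"

definition Lset :: "(real \<Rightarrow> 'a::metric_space) \<Rightarrow> real set \<Rightarrow> 'a set" where
  "Lset \<gamma> I = {y. \<forall>t\<in>int_oplus I.
      ((\<lambda>s. dist y (\<gamma> s)) has_real_derivative 1) (at t within (I \<inter> {t<..}))}"

definition Rset :: "(real \<Rightarrow> 'a::metric_space) \<Rightarrow> real set \<Rightarrow> 'a set" where
  "Rset \<gamma> I = {y. \<forall>t\<in>int_ominus I.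
      ((\<lambda>s. dist y (\<gamma> s)) has_real_derivative (-1)) (at t within (I \<inter> {..<t}))}"

definition frechet_medians :: "'w measure \<Rightarrow> ('w \<Rightarrow> 'a::metric_space) \<Rightarrow> 'a \<Rightarrow> 'a set" where
  "frechet_medians M Y x0 = {q. \<forall>p.
      integral\<^sup>L M (\<lambda>\<omega>. dist (Y \<omega>) q - dist (Y \<omega>) x0)
      \<le> integral\<^sup>L M (\<lambda>\<omega>. dist (Y \<omega>) p - dist (Y \<omega>) x0)}"

end

theory Submission
  imports Defs
begin

text \<open>If p and q are medians with midpoint m, then m is a median too, so the nonnegative gap
  (d(Y,p) + d(Y,q))/2 - d(Y,m) has mean zero. By the CN inequality a vanishing gap forces
  |d(Y,p) - d(Y,q)| = d(p,q), so almost surely d(Y,.) is an isometric coordinate on any finite set of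
  medians; hence the medians form a closed, bounded, midpoint-convex subset of a line. On this
  segment d(Y,.) has almost surely constant slope 1 or -1, and equality of the objective at the
  two endpoints makes both cases equally likely. Existence of a median follows from convexity and
  coercivity of the objective together with completeness.\<close>

section \<open>Midpoints and the CN inequality\<close>

text \<open>The Bruhat-Tits (CN) inequality itself serves as the notion of midpoint: half distances,
  uniqueness and convexity all follow from testing it at suitable \<open>y\<close>.\<close>

definition CN_midpoint :: "'a::metric_space \<Rightarrow> 'a \<Rightarrow> 'a \<Rightarrow> bool" where
  "CN_midpoint p q m \<longleftrightarrow> (\<forall>y. (dist y m)\<^sup>2 \<le> (dist y p)\<^sup>2 / 2 + (dist y q)\<^sup>2 / 2 - (dist p q)\<^sup>2 / 4)"

lemma hadamard_CN_midpoint: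
  fixes p q :: "'a::metric_space"
  assumes "hadamard (UNIV :: 'a set)"
  obtains m :: 'a where "CN_midpoint p q m"
proof -
  obtain m :: 'a where "\<forall>y. (1/2) * (dist p y)\<^sup>2 + (1/2) * (dist q y)\<^sup>2 - (1/4) * (dist p q)\<^sup>2 \<ge> (dist y m)\<^sup>2"
    using assms unfolding hadamard_def by blast
  then have "CN_midpoint p q m"
    unfolding CN_midpoint_def by (simp add: dist_commute)
  then show thesis by (rule that)
qed

text \<open>Testing at \<open>y = p\<close> and \<open>y = q\<close> bounds both distances by half
  of \<open>dist p q\<close>; the triangle inequality then leaves no slack.\<close>

lemma CN_midpoint_dist:
  assumes "CN_midpoint p q m"
  shows "dist p m = dist p q / 2" "dist q m = dist p q / 2"
proof -
  have "(dist p m)\<^sup>2 \<le> (dist p q / 2)\<^sup>2" "(dist q m)\<^sup>2 \<le> (dist p q / 2)\<^sup>2"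
    using assms[unfolded CN_midpoint_def, rule_format, of p]
      assms[unfolded CN_midpoint_def, rule_format, of q]
    by (simp_all add: power_divide dist_commute)
  then have "dist p m \<le> dist p q / 2" "dist q m \<le> dist p q / 2"
    by (auto intro: power2_le_imp_le)
  moreover have "dist p q \<le> dist p m + dist q m"
    by (metis dist_commute dist_triangle)
  ultimately show "dist p m = dist p q / 2" "dist q m = dist p q / 2" by linarith+
qed

lemma CN_midpoint_unique:
  assumes "CN_midpoint p q m" "dist p x = dist p q / 2" "dist q x = dist p q / 2"
  shows "x = m"
proof -
  have "(dist x m)\<^sup>2 \<le> 0"
    using assms(1)[unfolded CN_midpoint_def, rule_format, of x] assms(2,3)
    by (simp add: dist_commute power_divide)
  then show ?thesis by simp
qed

text \<open>By (a^2 + b^2)/2 = ((a + b)/2)^2 + ((a - b)/2)^2, the CN inequality acquires a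
  correction term that is nonnegative by the reverse triangle inequality. Dropping it gives
  convexity; equality in convexity forces it to vanish.\<close>

lemma CN_midpoint_quadratic:
  assumes "CN_midpoint p q m"
  shows "(dist y m)\<^sup>2 + ((dist p q)\<^sup>2 - (dist y p - dist y q)\<^sup>2) / 4 \<le> ((dist y p + dist y q) / 2)\<^sup>2"
  using assms[unfolded CN_midpoint_def, rule_format, of y]
  by (simp add: power_divide power2_sum power2_diff field_simps)

lemma abs_dist_diff_le_dist: "\<bar>dist y p - dist y q\<bar> \<le> dist p (q::'a::metric_space)"
  using abs_dist_diff_le[of p y q] by (simp add: dist_commute)

lemma CN_midpoint_convex:
  assumes "CN_midpoint p q m"
  shows "dist y m \<le> (dist y p + dist y q) / 2"
proof -
  have "(dist y p - dist y q)\<^sup>2 \<le> (dist p q)\<^sup>2"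
    using abs_dist_diff_le_dist[of y p q] by (simp add: abs_le_square_iff[symmetric])
  then have "(dist y m)\<^sup>2 \<le> ((dist y p + dist y q) / 2)\<^sup>2"
    by (intro order_trans[OF _ CN_midpoint_quadratic[OF assms, of y]]) simp
  then show ?thesis by (rule power2_le_imp_le) simp
qed

lemma CN_midpoint_convex_eq:
  assumes "CN_midpoint p q m" "dist y m = (dist y p + dist y q) / 2"
  shows "\<bar>dist y p - dist y q\<bar> = dist p q"
proof -
  have "(dist p q)\<^sup>2 \<le> (dist y p - dist y q)\<^sup>2"
    using CN_midpoint_quadratic[OF assms(1), of y] assms(2) by simp
  then have "dist p q \<le> \<bar>dist y p - dist y q\<bar>"
    using abs_le_square_iff[of "dist p q" "dist y p - dist y q"] by simp
  with abs_dist_diff_le_dist[of y p q] show ?thesis by simp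
qed

section \<open>Minimizers of convex coercive functions\<close>

text \<open>Bounded closed convex sets have the nested intersection property: approximate projections of
  a base point onto the sublevel sets form a Cauchy sequence, by the CN inequality.\<close>

lemma hadamard_convex_coercive_minimizer:
  fixes F :: "'a::metric_space \<Rightarrow> real"
  assumes H: "hadamard (UNIV :: 'a set)"
    and conv: "\<And>p q m. CN_midpoint p q m \<Longrightarrow> F m \<le> (F p + F q) / 2"
    and cont: "continuous_on UNIV F"
    and c: "c > 0" and coercive: "\<And>q. c * dist x0 q - k \<le> F q"
  obtains q where "\<And>p. F q \<le> F p"
proof -
  define v where "v = Inf (range F)"
  \<comment> \<open>\<open>C n\<close> is a shrinking family of nonempty sublevel sets and
    \<open>r n\<close> the squared distance from \<open>x0\<close> to \<open>C n\<close>;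
    \<open>Suc n\<close> keeps the denominator positive at \<open>n = 0\<close>.\<close>
  define C where "C n = {q. F q \<le> v + 1 / real (Suc n)}" for n
  define r where "r n = (INF q\<in>C n. (dist x0 q)\<^sup>2)" for n
  have "- k \<le> F q" for q
    using coercive[of q] mult_nonneg_nonneg[OF less_imp_le[OF c] zero_le_dist[of x0 q]] by linarith
  then have bdd: "bdd_below (range F)" by (auto intro!: bdd_belowI)
  have ne: "C n \<noteq> {}" for n
  proof -
    have "v < v + 1 / real (Suc n)" by simp
    then obtain q where "F q < v + 1 / real (Suc n)"
      unfolding v_def by (subst (asm) cInf_less_iff[OF _ bdd]) auto
    then show ?thesis unfolding C_def by (auto intro: less_imp_le)
  qed
  have bddr: "bdd_below ((\<lambda>q. (dist x0 q)\<^sup>2) ` C n)" for n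
    by (rule bdd_belowI[of _ 0]) auto
  have Csub: "C m \<subseteq> C n" if "n \<le> m" for n m
  proof -
    have "1 / real (Suc m) \<le> 1 / real (Suc n)" using that by (simp add: frac_le)
    then show ?thesis unfolding C_def by auto
  qed
  have rle: "r n \<le> (dist x0 q)\<^sup>2" if "q \<in> C n" for q n
    unfolding r_def by (rule cINF_lower[OF bddr that])
  have rmono: "incseq r"
    unfolding incseq_def
  proof (intro allI impI)
    fix n m :: nat assume "n \<le> m"
    then show "r n \<le> r m"
      unfolding r_def using Csub by (intro cINF_superset_mono[OF ne bddr]) auto
  qed
  \<comment> \<open>Every \<open>C n\<close> lies where \<open>F\<close> is at most
    \<open>v + 1\<close>, so coercivity bounds its distance from \<open>x0\<close> independently of
    \<open>n\<close>. The increasing sequence \<open>r\<close> therefore converges.\<close>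
  have bnd: "r n \<le> ((v + 1 + k) / c)\<^sup>2" for n
  proof -
    obtain q where q: "q \<in> C n" using ne by blast
    have "1 / real (Suc n) \<le> 1" by simp
    then have "c * dist x0 q \<le> v + 1 + k"
      using coercive[of q] q unfolding C_def mem_Collect_eq by linarith
    then have "dist x0 q \<le> (v + 1 + k) / c" using c by (simp add: field_simps)
    then have "(dist x0 q)\<^sup>2 \<le> ((v + 1 + k) / c)\<^sup>2" by (intro power_mono) auto
    with rle[OF q] show ?thesis by linarith
  qed
  obtain R where R: "r \<longlonglongrightarrow> R" "\<And>n. r n \<le> R"
    using incseq_convergent[OF rmono] bnd by blast
  have "\<exists>q\<in>C n. (dist x0 q)\<^sup>2 < r n + 1 / real (Suc n)" for n
  proof -
    have "r n < r n + 1 / real (Suc n)" by simp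
    then show ?thesis
      unfolding r_def by (subst (asm) cINF_less_iff[OF ne bddr]) auto
  qed
  then obtain p where p: "\<And>n. p n \<in> C n" "\<And>n. (dist x0 (p n))\<^sup>2 < r n + 1 / real (Suc n)"
    by metis
  \<comment> \<open>The midpoint \<open>z\<close> stays in the convex set \<open>C n\<close>, hence
    its squared distance to \<open>x0\<close> is at least \<open>r n\<close>. Two near-projections
    that are far apart would, by CN, have a midpoint closer to \<open>x0\<close> than that.\<close>
  have dp: "(dist (p n) (p m))\<^sup>2 \<le> 2 * (R - r n) + 4 / real (Suc n)" if "n \<le> m" for n m
  proof -
    obtain z where z: "CN_midpoint (p n) (p m) z" using hadamard_CN_midpoint[OF H] by blast
    have "p m \<in> C n" using p(1)[of m] Csub[OF that] by blast
    then have "(F (p n) + F (p m)) / 2 \<le> v + 1 / real (Suc n)"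
      using p(1)[of n] unfolding C_def by simp
    then have "z \<in> C n" using conv[OF z] unfolding C_def mem_Collect_eq by (rule order_trans[rotated])
    then have "r n \<le> (dist x0 z)\<^sup>2" by (rule rle)
    also have "\<dots> \<le> (dist x0 (p n))\<^sup>2 / 2 + (dist x0 (p m))\<^sup>2 / 2 - (dist (p n) (p m))\<^sup>2 / 4"
      using z unfolding CN_midpoint_def by blast
    finally have "(dist (p n) (p m))\<^sup>2 \<le> 2 * (dist x0 (p n))\<^sup>2 + 2 * (dist x0 (p m))\<^sup>2 - 4 * r n"
      by (simp add: field_simps)
    moreover have "1 / real (Suc m) \<le> 1 / real (Suc n)" using that by (simp add: frac_le)
    moreover have "4 / real (Suc n) = 4 * (1 / real (Suc n))" by simp
    ultimately show ?thesis using p(2)[of n] p(2)[of m] R(2)[of m] by argo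
  qed
  have lim0: "(\<lambda>n. 2 * (R - r n) + 4 / real (Suc n)) \<longlonglongrightarrow> 2 * (R - R) + 0"
    by (intro tendsto_intros R LIMSEQ_Suc[OF lim_const_over_n])
  have "Cauchy p"
    unfolding Cauchy_altdef2
  proof (intro allI impI)
    fix e :: real assume "e > 0"
    then have "eventually (\<lambda>n. 2 * (R - r n) + 4 / real (Suc n) < e\<^sup>2) sequentially"
      using order_tendstoD(2)[OF lim0, of "e\<^sup>2"] by simp
    then obtain N where N: "2 * (R - r N) + 4 / real (Suc N) < e\<^sup>2"
      unfolding eventually_sequentially by blast
    have "dist (p n) (p N) < e" if "N \<le> n" for n
      using dp[OF that] N \<open>e > 0\<close>
      by (metis dist_commute order_le_less_trans power2_less_imp_less less_imp_le)
    then show "\<exists>N. \<forall>n\<ge>N. dist (p n) (p N) < e" by blast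
  qed
  then obtain l where l: "p \<longlonglongrightarrow> l"
    using H unfolding hadamard_def Real_Vector_Spaces.complete_def by blast
  have "(\<lambda>n. F (p n)) \<longlonglongrightarrow> F l"
    using continuous_on_tendsto_compose[OF cont l] by simp
  moreover have "(\<lambda>n. v + 1 / real (Suc n)) \<longlonglongrightarrow> v + 0"
    by (intro tendsto_intros LIMSEQ_Suc[OF lim_const_over_n])
  ultimately have "F l \<le> v + 0"
    by (rule LIMSEQ_le) (use p(1) in \<open>auto simp: C_def\<close>)
  moreover have "v \<le> F q" for q unfolding v_def by (rule cInf_lower[OF _ bdd]) simp
  ultimately show thesis by (intro that[of l]) (metis add_0_right order_trans)
qed

section \<open>Closed intervals and isometric coordinates on the real line\<close>

text \<open>Let \<open>s\<close> and \<open>t\<close> be the points of \<open>S\<close> nearest to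
  \<open>x\<close> from below and above. Their midpoint belongs to \<open>S\<close> and cannot lie
  strictly between \<open>s\<close> and \<open>t\<close>, so \<open>s\<close> and \<open>t\<close>
  coincide with \<open>x\<close>.\<close>

lemma closed_midpoint_imp_is_interval:
  fixes S :: "real set"
  assumes S: "closed S" and mid: "\<And>u v. u \<in> S \<Longrightarrow> v \<in> S \<Longrightarrow> (u + v) / 2 \<in> S"
  shows "is_interval S"
  unfolding is_interval_1
proof (intro ballI allI impI)
  fix u v x assume uv: "u \<in> S" "v \<in> S" and x: "u \<le> x \<and> x \<le> v"
  define s where "s = Sup (S \<inter> {u..x})"
  define t where "t = Inf (S \<inter> {x..v})"
  have s: "s \<in> S \<inter> {u..x}" unfolding s_def
    by (rule closed_contains_Sup) (use S uv x in \<open>auto intro!: closed_Int\<close>)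
  have t: "t \<in> S \<inter> {x..v}" unfolding t_def
    by (rule closed_contains_Inf) (use S uv x in \<open>auto intro!: closed_Int\<close>)
  have m: "(s + t) / 2 \<in> S" using mid s t by blast
  show "x \<in> S"
  proof (cases "(s + t) / 2 \<le> x")
    case True
    then have "(s + t) / 2 \<le> s"
      unfolding s_def using m s t x by (intro cSup_upper) (auto simp: s_def[symmetric])
    then show ?thesis using s t by (cases "s = x") auto
  next
    case False
    then have "t \<le> (s + t) / 2"
      unfolding t_def using m s t x by (intro cInf_lower) (auto simp: t_def[symmetric])
    then show ?thesis using s t by (cases "t = x") auto
  qed
qed

text \<open>Connected compact subsets of the line are closed intervals; the empty set is covered by
  \<open>a > b\<close>.\<close>

lemma interval_complete_bounded_imp_Icc:
  fixes S :: "real set"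
  assumes "is_interval S" "Topological_Spaces.complete S" "bounded S"
  obtains a b where "S = {a..b}"
proof -
  have "connected S" using assms(1) by (simp add: is_interval_connected_1)
  moreover have "compact S"
    using complete_imp_closed[OF assms(2)] assms(3) by (simp add: compact_eq_bounded_closed)
  ultimately have "\<exists>a b. S = {a..b}"
    using connected_compact_interval_1[of S] by simp
  then show thesis using that by blast
qed

text \<open>Cauchy sequences pull back along an isometry. This transfers completeness from the
  medians to their coordinates, and later to the domain of a given geodesic.\<close>

lemma isometry_to_real_complete_image:
  fixes \<phi> :: "'a::metric_space \<Rightarrow> real"
  assumes "Topological_Spaces.complete S" and iso: "\<And>x y. x \<in> S \<Longrightarrow> y \<in> S \<Longrightarrow> \<bar>\<phi> x - \<phi> y\<bar> = dist x y"
  shows "Topological_Spaces.complete (\<phi> ` S)"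
  unfolding Real_Vector_Spaces.complete_def
proof (intro allI impI)
  fix f assume f: "(\<forall>n. f n \<in> \<phi> ` S) \<and> Cauchy f"
  then have "\<forall>n. \<exists>x. x \<in> S \<and> f n = \<phi> x" by blast
  then obtain g where "\<forall>n. g n \<in> S \<and> f n = \<phi> (g n)" by (rule choice[THEN exE])
  then have g: "\<And>n. g n \<in> S" "f = (\<lambda>n. \<phi> (g n))" by auto
  with f have "Cauchy g"
    unfolding Cauchy_def by (simp add: dist_real_def iso)
  then obtain l where l: "l \<in> S" "g \<longlonglongrightarrow> l"
    using assms(1) g unfolding Real_Vector_Spaces.complete_def by blast
  have "dist (f n) (\<phi> l) = dist (g n) l" for n
    using g l iso by (simp add: dist_real_def)
  then have "f \<longlonglongrightarrow> \<phi> l" using l(2) by (simp add: lim_sequentially)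
  then show "\<exists>l\<in>\<phi> ` S. f \<longlonglongrightarrow> l" using l by blast
qed

section \<open>One-sided derivatives along a geodesic and the sets L and R\<close>

text \<open>Repeated halving towards \<open>e\<close> shows that the difference quotients at the
  dyadic points \<open>e + (c - e) / 2 ^ n\<close>, scaled by \<open>c - e\<close>, stay below the
  increment over the whole segment; they converge to the derivative term. Since
  \<open>closed_segment\<close> is unoriented, \<open>c < e\<close> is allowed, so right and left
  derivatives are treated alike.\<close>

lemma derivative_le_secant_of_midpoint_convex:
  fixes f :: "real \<Rightarrow> real"
  assumes mid: "\<And>u. u \<in> closed_segment e c \<Longrightarrow> f ((e + u) / 2) \<le> (f e + f u) / 2"
    and der: "(f has_real_derivative D) (at e within (closed_segment e c - {e}))"
    and "e \<noteq> c"
  shows "D * (c - e) \<le> f c - f e"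
proof -
  define t where "t n = e + (c - e) / 2 ^ n" for n :: nat
  have tseg: "t n \<in> closed_segment e c" for n
    unfolding in_segment t_def
    by (rule exI[of _ "1 / 2 ^ n"]) (simp add: field_simps)
  have tne: "t n \<noteq> e" for n using \<open>e \<noteq> c\<close> by (simp add: t_def)
  have le: "f (t n) - f e \<le> (f c - f e) / 2 ^ n" for n
  proof (induction n)
    case 0 then show ?case by (simp add: t_def)
  next
    case (Suc n)
    have "(e + t n) / 2 = t (Suc n)" by (simp add: t_def field_simps)
    then have "f (t (Suc n)) - f e \<le> (f (t n) - f e) / 2"
      using mid[OF tseg[of n]] by (simp add: field_simps)
    also have "\<dots> \<le> (f c - f e) / 2 ^ n / 2" using Suc by (rule divide_right_mono) simp
    finally show ?case by (simp add: mult.commute)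
  qed
  have "(\<lambda>n. (c - e) * (1 / 2) ^ n) \<longlonglongrightarrow> (c - e) * 0"
    by (intro tendsto_intros LIMSEQ_realpow_zero) auto
  then have "(\<lambda>n. e + (c - e) * (1 / 2) ^ n) \<longlonglongrightarrow> e + (c - e) * 0"
    by (rule tendsto_add[OF tendsto_const])
  then have "t \<longlonglongrightarrow> e" by (simp add: t_def[abs_def] power_divide)
  then have "filterlim t (at e within (closed_segment e c - {e})) sequentially"
    unfolding filterlim_at using tseg tne by simp
  with der have "(\<lambda>n. (f (t n) - f e) / (t n - e)) \<longlonglongrightarrow> D"
    unfolding has_field_derivative_iff by (rule filterlim_compose)
  then have "(\<lambda>n. (f (t n) - f e) / (t n - e) * (c - e)) \<longlonglongrightarrow> D * (c - e)"
    by (intro tendsto_intros)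
  moreover have "(f (t n) - f e) / (t n - e) * (c - e) \<le> f c - f e" for n
  proof -
    have "(f (t n) - f e) / (t n - e) * (c - e) = (f (t n) - f e) * 2 ^ n"
      using \<open>e \<noteq> c\<close> by (simp add: t_def)
    then show ?thesis using le[of n] by (simp add: pos_le_divide_eq)
  qed
  ultimately show ?thesis by (intro LIMSEQ_le_const2) auto
qed

text \<open>The parameter midpoint is at half distance from both ends, so uniqueness identifies its
  image with the CN midpoint.\<close>

lemma dist_geodesic_midpoint_convex:
  fixes \<gamma> :: "real \<Rightarrow> 'a::metric_space"
  assumes H: "hadamard (UNIV :: 'a set)" and g: "unit_geodesic \<gamma> I" and st: "s \<in> I" "t \<in> I"
  shows "dist y (\<gamma> ((s + t) / 2)) \<le> (dist y (\<gamma> s) + dist y (\<gamma> t)) / 2"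
proof -
  obtain m where m: "CN_midpoint (\<gamma> s) (\<gamma> t) m" using hadamard_CN_midpoint[OF H] by blast
  have iv: "is_interval I" and d: "\<And>u v. u \<in> I \<Longrightarrow> v \<in> I \<Longrightarrow> dist (\<gamma> u) (\<gamma> v) = \<bar>u - v\<bar>"
    using g unfolding unit_geodesic_def by auto
  have mI: "(s + t) / 2 \<in> I"
  proof (cases "s \<le> t")
    case True
    then show ?thesis by (intro mem_is_interval_1_I[OF iv st]) simp_all
  next
    case False
    then show ?thesis by (intro mem_is_interval_1_I[OF iv st(2,1)]) simp_all
  qed
  have "\<gamma> ((s + t) / 2) = m"
    by (rule CN_midpoint_unique[OF m]) (auto simp: d st mI abs_if field_simps)
  then show ?thesis using CN_midpoint_convex[OF m] by simp
qed

text \<open>Convexity propagates slope 1 at \<open>a\<close> to an increment of at least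
  \<open>b - a\<close>, the maximum that the triangle inequality permits. The derivative condition
  thus becomes an equation between two distances, which is plainly measurable.\<close>

lemma Lset_segment_eq:
  fixes \<gamma> :: "real \<Rightarrow> 'a::metric_space"
  assumes H: "hadamard (UNIV :: 'a set)" and g: "unit_geodesic \<gamma> {a..b}" and ab: "a < b"
  shows "Lset \<gamma> {a..b} = {y. dist y (\<gamma> b) - dist y (\<gamma> a) = b - a}"
proof (intro set_eqI iffI)
  have d: "\<And>u v. u \<in> {a..b} \<Longrightarrow> v \<in> {a..b} \<Longrightarrow> dist (\<gamma> u) (\<gamma> v) = \<bar>u - v\<bar>"
    using g unfolding unit_geodesic_def by auto
  fix y
  {
    assume "y \<in> Lset \<gamma> {a..b}"
    moreover have "a \<in> int_oplus {a..b}" using ab by (auto simp: int_oplus_def)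
    ultimately have "((\<lambda>s. dist y (\<gamma> s)) has_real_derivative 1) (at a within ({a..b} \<inter> {a<..}))"
      unfolding Lset_def by blast
    moreover have "{a..b} \<inter> {a<..} = closed_segment a b - {a}"
      using ab by (auto simp: closed_segment_eq_real_ivl)
    ultimately have "1 * (b - a) \<le> dist y (\<gamma> b) - dist y (\<gamma> a)"
      using ab dist_geodesic_midpoint_convex[OF H g]
      by (intro derivative_le_secant_of_midpoint_convex) (auto simp: closed_segment_eq_real_ivl)
    moreover have "\<bar>dist y (\<gamma> b) - dist y (\<gamma> a)\<bar> \<le> b - a"
      using abs_dist_diff_le_dist[of y "\<gamma> b" "\<gamma> a"] d[of b a] ab by simp
    ultimately show "y \<in> {y. dist y (\<gamma> b) - dist y (\<gamma> a) = b - a}" by simp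
  next
    assume y: "y \<in> {y. dist y (\<gamma> b) - dist y (\<gamma> a) = b - a}"
    \<comment> \<open>The increments over \<open>[a, s]\<close> and \<open>[s, b]\<close> are at
      most the lengths of these pieces and add up to \<open>b - a\<close>, so both bounds are
      attained.\<close>
    have eq: "dist y (\<gamma> s) = dist y (\<gamma> a) + (s - a)" if "s \<in> {a..b}" for s
      using abs_dist_diff_le_dist[of y "\<gamma> b" "\<gamma> s"] abs_dist_diff_le_dist[of y "\<gamma> s" "\<gamma> a"]
        d[of b s] d[of s a] that y by simp
    have "((\<lambda>s. dist y (\<gamma> s)) has_real_derivative 1) (at t within ({a..b} \<inter> {t<..}))"
      if "t \<in> {a..b}" for t
    proof -
      have "((\<lambda>s. dist y (\<gamma> a) + (s - a)) has_real_derivative 1) (at t within {a..b})"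
        by (auto intro!: derivative_eq_intros)
      then have "((\<lambda>s. dist y (\<gamma> s)) has_real_derivative 1) (at t within {a..b})"
        by (rule has_field_derivative_transform_within[OF _ zero_less_one that]) (simp only: eq[symmetric])
      then show ?thesis by (rule DERIV_subset) auto
    qed
    then show "y \<in> Lset \<gamma> {a..b}" by (simp add: Lset_def int_oplus_def)
  }
qed

text \<open>Mirror image of the previous argument: the left derivative at \<open>b\<close> is
  compared with the secant of the segment run from \<open>b\<close> to \<open>a\<close>.\<close>

lemma Rset_segment_eq:
  fixes \<gamma> :: "real \<Rightarrow> 'a::metric_space"
  assumes H: "hadamard (UNIV :: 'a set)" and g: "unit_geodesic \<gamma> {a..b}" and ab: "a < b"
  shows "Rset \<gamma> {a..b} = {y. dist y (\<gamma> a) - dist y (\<gamma> b) = b - a}"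
proof (intro set_eqI iffI)
  have d: "\<And>u v. u \<in> {a..b} \<Longrightarrow> v \<in> {a..b} \<Longrightarrow> dist (\<gamma> u) (\<gamma> v) = \<bar>u - v\<bar>"
    using g unfolding unit_geodesic_def by auto
  fix y
  {
    assume "y \<in> Rset \<gamma> {a..b}"
    moreover have "b \<in> int_ominus {a..b}" using ab by (auto simp: int_ominus_def)
    ultimately have "((\<lambda>s. dist y (\<gamma> s)) has_real_derivative -1) (at b within ({a..b} \<inter> {..<b}))"
      unfolding Rset_def by blast
    moreover have "{a..b} \<inter> {..<b} = closed_segment b a - {b}"
      using ab by (auto simp: closed_segment_eq_real_ivl)
    ultimately have "-1 * (a - b) \<le> dist y (\<gamma> a) - dist y (\<gamma> b)"
      using ab dist_geodesic_midpoint_convex[OF H g]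
      by (intro derivative_le_secant_of_midpoint_convex) (auto simp: closed_segment_eq_real_ivl)
    moreover have "\<bar>dist y (\<gamma> b) - dist y (\<gamma> a)\<bar> \<le> b - a"
      using abs_dist_diff_le_dist[of y "\<gamma> b" "\<gamma> a"] d[of b a] ab by simp
    ultimately show "y \<in> {y. dist y (\<gamma> a) - dist y (\<gamma> b) = b - a}" by simp
  next
    assume y: "y \<in> {y. dist y (\<gamma> a) - dist y (\<gamma> b) = b - a}"
    have eq: "dist y (\<gamma> s) = dist y (\<gamma> a) - (s - a)" if "s \<in> {a..b}" for s
      using abs_dist_diff_le_dist[of y "\<gamma> b" "\<gamma> s"] abs_dist_diff_le_dist[of y "\<gamma> s" "\<gamma> a"]
        d[of b s] d[of s a] that y by simp
    have "((\<lambda>s. dist y (\<gamma> s)) has_real_derivative -1) (at t within ({a..b} \<inter> {..<t}))"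
      if "t \<in> {a..b}" for t
    proof -
      have "((\<lambda>s. dist y (\<gamma> a) - (s - a)) has_real_derivative -1) (at t within {a..b})"
        by (auto intro!: derivative_eq_intros)
      then have "((\<lambda>s. dist y (\<gamma> s)) has_real_derivative -1) (at t within {a..b})"
        by (rule has_field_derivative_transform_within[OF _ zero_less_one that]) (simp only: eq[symmetric])
      then show ?thesis by (rule DERIV_subset) auto
    qed
    then show "y \<in> Rset \<gamma> {a..b}" by (simp add: Rset_def int_ominus_def)
  }
qed

section \<open>The objective function: continuity, convexity, coercivity\<close>

locale hadamard_random_variable = prob_space M
  for M :: "'w measure" +
  fixes Y :: "'w \<Rightarrow> 'a::metric_space" and x0 :: 'a
  assumes H: "hadamard (UNIV :: 'a set)" and Y [measurable]: "Y \<in> borel_measurable M"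
begin

text \<open>Subtracting the distance to \<open>x0\<close> keeps the integrand bounded by
  \<open>dist q x0\<close>, so \<open>F\<close> is finite for every law of \<open>Y\<close>;
  moreover \<open>F x0 = 0\<close>.\<close>

definition F :: "'a \<Rightarrow> real" where
  "F q = (\<integral>\<omega>. dist (Y \<omega>) q - dist (Y \<omega>) x0 \<partial>M)"

lemma medians_eq: "frechet_medians M Y x0 = {q. \<forall>p. F q \<le> F p}"
  by (simp add: frechet_medians_def F_def)

lemma dist_Y_measurable [measurable]: "(\<lambda>\<omega>. dist (Y \<omega>) q) \<in> borel_measurable M"
proof -
  have "(\<lambda>y. dist y q) \<in> borel_measurable borel"
    by (intro borel_measurable_continuous_onI continuous_intros)
  then show ?thesis using Y by measurable
qed

lemma integrable_dist_diff [simp]: "integrable M (\<lambda>\<omega>. dist (Y \<omega>) p - dist (Y \<omega>) q)"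
  by (rule integrable_const_bound[of _ "dist p q"])
    (auto simp: abs_dist_diff_le_dist)

lemma F_diff: "F p - F q = (\<integral>\<omega>. dist (Y \<omega>) p - dist (Y \<omega>) q \<partial>M)"
  unfolding F_def by (subst Bochner_Integration.integral_diff[symmetric]) simp_all

lemma F_diff_le: "F p - F q \<le> dist p q"
proof -
  have "F p - F q \<le> (\<integral>\<omega>. dist p q \<partial>M)"
    unfolding F_diff
    by (intro integral_mono) (auto intro: order_trans[OF abs_ge_self abs_dist_diff_le_dist])
  then show ?thesis by (simp add: prob_space)
qed

lemma continuous_on_F: "continuous_on UNIV F"
proof -
  have "dist (F p) (F q) \<le> 1 * dist p q" for p q
    using F_diff_le[of p q] F_diff_le[of q p] by (simp add: dist_real_def dist_commute)
  then have "1-lipschitz_on UNIV F" by (intro lipschitz_onI) auto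
  then show ?thesis by (rule lipschitz_on_continuous_on)
qed

text \<open>Single distances to \<open>Y\<close> may fail to be integrable, so the gap is split into
  halves of the bounded differences against \<open>m\<close>.\<close>

lemma F_midpoint_gap:
  "(F p + F q) / 2 - F m = (\<integral>\<omega>. (dist (Y \<omega>) p + dist (Y \<omega>) q) / 2 - dist (Y \<omega>) m \<partial>M)"
  "integrable M (\<lambda>\<omega>. (dist (Y \<omega>) p + dist (Y \<omega>) q) / 2 - dist (Y \<omega>) m)"
proof -
  have eq: "(dist (Y \<omega>) p + dist (Y \<omega>) q) / 2 - dist (Y \<omega>) m
      = (dist (Y \<omega>) p - dist (Y \<omega>) m) / 2 + (dist (Y \<omega>) q - dist (Y \<omega>) m) / 2" for \<omega>
    by (simp add: field_simps)
  have "(F p + F q) / 2 - F m = (F p - F m) / 2 + (F q - F m) / 2" by (simp add: field_simps)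
  also have "\<dots> = (\<integral>\<omega>. (dist (Y \<omega>) p - dist (Y \<omega>) m) / 2 + (dist (Y \<omega>) q - dist (Y \<omega>) m) / 2 \<partial>M)"
    unfolding F_diff by (subst Bochner_Integration.integral_add) simp_all
  finally show "(F p + F q) / 2 - F m = (\<integral>\<omega>. (dist (Y \<omega>) p + dist (Y \<omega>) q) / 2 - dist (Y \<omega>) m \<partial>M)"
    unfolding eq .
  show "integrable M (\<lambda>\<omega>. (dist (Y \<omega>) p + dist (Y \<omega>) q) / 2 - dist (Y \<omega>) m)"
    unfolding eq by (intro Bochner_Integration.integrable_add integrable_divide) simp_all
qed

lemma F_midpoint_convex:
  assumes "CN_midpoint p q m"
  shows "F m \<le> (F p + F q) / 2"
proof -
  have "0 \<le> (F p + F q) / 2 - F m"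
    unfolding F_midpoint_gap
    by (intro Bochner_Integration.integral_nonneg) (simp only: diff_ge_0_iff_ge CN_midpoint_convex[OF assms])
  then show ?thesis by simp
qed

text \<open>Write D for \<open>dist x0 q\<close>. On an event of probability above 3/4 where
  \<open>Y\<close> is within \<open>n\<close> of \<open>x0\<close>, the integrand is at least D -
  2n; elsewhere it is at least -D. The mean is then at least -D + 2(D - n)(3/4) = D/2 - 3n/2,
  provided D > n.\<close>

lemma F_coercive:
  obtains r where "\<And>q. dist x0 q / 2 - 3 / 2 * r \<le> F q"
proof -
  have "(\<lambda>n. measure M {\<omega>\<in>space M. dist (Y \<omega>) x0 \<le> real n})
      \<longlonglongrightarrow> measure M (\<Union>n. {\<omega>\<in>space M. dist (Y \<omega>) x0 \<le> real n})"
    by (rule finite_Lim_measure_incseq) (auto simp: incseq_def intro: order_trans)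
  moreover have "(\<Union>n. {\<omega>\<in>space M. dist (Y \<omega>) x0 \<le> real n}) = space M"
    using real_arch_simple by auto
  ultimately have "(\<lambda>n. measure M {\<omega>\<in>space M. dist (Y \<omega>) x0 \<le> real n}) \<longlonglongrightarrow> 1"
    by (simp add: prob_space)
  then have "eventually (\<lambda>n. 3/4 < measure M {\<omega>\<in>space M. dist (Y \<omega>) x0 \<le> real n}) sequentially"
    by (rule order_tendstoD) simp
  then obtain n where n: "3/4 < measure M {\<omega>\<in>space M. dist (Y \<omega>) x0 \<le> real n}"
    unfolding eventually_sequentially by blast
  define E where "E = {\<omega>\<in>space M. dist (Y \<omega>) x0 \<le> real n}"
  have E: "E \<in> sets M" unfolding E_def by measurable
  have "dist x0 q / 2 - 3 / 2 * real n \<le> F q" for q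
  proof (cases "dist x0 q \<le> real n")
    case True
    \<comment> \<open>For D at most n, the Lipschitz bound -D already exceeds D/2 - 3n/2.\<close>
    have "F x0 = 0" by (simp add: F_def)
    then show ?thesis using F_diff_le[of x0 q] True by simp
  next
    case False
    have "- dist x0 q + 2 * (dist x0 q - real n) * measure M E
        = (\<integral>\<omega>. - dist x0 q + 2 * (dist x0 q - real n) * indicator E \<omega> \<partial>M)"
      using E by (subst Bochner_Integration.integral_add) (simp_all add: prob_space emeasure_eq_measure)
    also have "\<dots> \<le> F q"
      unfolding F_def
    proof (intro integral_mono)
      fix \<omega> assume w: "\<omega> \<in> space M"
      show "- dist x0 q + 2 * (dist x0 q - real n) * indicator E \<omega> \<le> dist (Y \<omega>) q - dist (Y \<omega>) x0"
        using abs_dist_diff_le_dist[of "Y \<omega>" q x0] dist_triangle[of x0 q "Y \<omega>"] w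
        by (auto simp: E_def indicator_def dist_commute)
    qed (use E in \<open>auto intro!: integrable_real_indicator simp: emeasure_eq_measure\<close>)
    finally have "- dist x0 q + 2 * (dist x0 q - real n) * measure M E \<le> F q" .
    moreover have "2 * (dist x0 q - real n) * (3/4) \<le> 2 * (dist x0 q - real n) * measure M E"
      using n False unfolding E_def by (intro mult_left_mono) auto
    ultimately show ?thesis by (simp add: field_simps)
  qed
  then show thesis by (rule that)
qed

section \<open>Structure of the set of medians\<close>

abbreviation Med :: "'a set" where "Med \<equiv> frechet_medians M Y x0"

lemma medians_nonempty: "Med \<noteq> {}"
proof -
  obtain r where "\<And>q. dist x0 q / 2 - 3 / 2 * r \<le> F q" using F_coercive by blast
  then obtain q where "\<And>p. F q \<le> F p"
    using hadamard_convex_coercive_minimizer[OF H F_midpoint_convex continuous_on_F, of "1/2" x0 "3 / 2 * r"]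
    by auto
  then show ?thesis by (auto simp: medians_eq)
qed

lemma medians_bounded: "bounded Med"
proof -
  obtain r where r: "\<And>q. dist x0 q / 2 - 3 / 2 * r \<le> F q" using F_coercive by blast
  have "dist x0 q \<le> 3 * r" if "q \<in> Med" for q
  proof -
    have "F q \<le> F x0" using that by (simp add: medians_eq)
    moreover have "F x0 = 0" by (simp add: F_def)
    ultimately show ?thesis using r[of q] by simp
  qed
  then show ?thesis unfolding bounded_def by blast
qed

lemma medians_complete: "Topological_Spaces.complete Med"
proof -
  have "Med = (\<Inter>p. {q. F q \<le> F p})" by (auto simp: medians_eq)
  also have "closed \<dots>"
    by (intro closed_INT ballI closed_Collect_le continuous_on_F continuous_on_const)
  finally have "closed Med" .
  then show ?thesis
    using complete_Int_closed[of UNIV Med] H unfolding hadamard_def by simp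
qed

lemma medians_midpoint:
  assumes "p \<in> Med" "q \<in> Med" "CN_midpoint p q m"
  shows "m \<in> Med"
  unfolding medians_eq
proof (intro CollectI allI)
  fix z
  have "F p \<le> F z" "F q \<le> F z" using assms by (auto simp: medians_eq)
  then show "F m \<le> F z" using F_midpoint_convex[OF assms(3)] by (simp add: field_simps)
qed

text \<open>The convexity gap at the midpoint integrates to zero, and the CN inequality turns its
  vanishing into the extremal case of the triangle inequality.\<close>

lemma medians_AE_aligned:
  assumes "p \<in> Med" "q \<in> Med"
  shows "AE \<omega> in M. \<bar>dist (Y \<omega>) p - dist (Y \<omega>) q\<bar> = dist p q"
proof -
  obtain m where m: "CN_midpoint p q m" using hadamard_CN_midpoint[OF H] by blast
  have "m \<in> Med" using medians_midpoint[OF assms m] .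
  then have "F p = F m" "F q = F m"
    using assms by (auto simp: medians_eq intro: antisym)
  then have "(\<integral>\<omega>. (dist (Y \<omega>) p + dist (Y \<omega>) q) / 2 - dist (Y \<omega>) m \<partial>M) = 0"
    unfolding F_midpoint_gap(1)[symmetric] by simp
  then have "AE \<omega> in M. (dist (Y \<omega>) p + dist (Y \<omega>) q) / 2 - dist (Y \<omega>) m = 0"
    using CN_midpoint_convex[OF m]
    by (subst (asm) integral_nonneg_eq_0_iff_AE[OF F_midpoint_gap(2)]) auto
  then show ?thesis
    by eventually_elim (rule CN_midpoint_convex_eq[OF m], simp)
qed

text \<open>Almost every \<open>Y \<omega>\<close> gives a signed coordinate on finitely many
  medians, but the exceptional null set varies with the points. The coordinate is therefore defined
  from the distances to two anchors \<open>p\<close>, \<open>q\<close> alone, and for each pair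
  \<open>x\<close>, \<open>y\<close> one good value \<open>z\<close> of \<open>Y\<close> verifies
  the isometry.\<close>

lemma medians_coordinate:
  obtains \<phi> :: "'a \<Rightarrow> real"
  where "\<And>x y. x \<in> Med \<Longrightarrow> y \<in> Med \<Longrightarrow> \<bar>\<phi> x - \<phi> y\<bar> = dist x y"
proof (cases "\<exists>p q. p \<in> Med \<and> q \<in> Med \<and> p \<noteq> q")
  case False
  then show thesis by (intro that[of "\<lambda>_. 0"]) (auto simp: dist_eq_0_iff)
next
  case True
  then obtain p q where pq: "p \<in> Med" "q \<in> Med" "p \<noteq> q" by blast
  \<comment> \<open>On a line through \<open>p\<close> and \<open>q\<close> this is the signed
    position measured from their midpoint.\<close>
  define \<phi> where "\<phi> x = ((dist x p)\<^sup>2 - (dist x q)\<^sup>2) / (2 * dist p q)" for x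
  have "\<bar>\<phi> x - \<phi> y\<bar> = dist x y" if xy: "x \<in> Med" "y \<in> Med" for x y
  proof -
    have "AE \<omega> in M. \<bar>dist (Y \<omega>) x - dist (Y \<omega>) p\<bar> = dist x p \<and> \<bar>dist (Y \<omega>) x - dist (Y \<omega>) q\<bar> = dist x q
      \<and> \<bar>dist (Y \<omega>) y - dist (Y \<omega>) p\<bar> = dist y p \<and> \<bar>dist (Y \<omega>) y - dist (Y \<omega>) q\<bar> = dist y q
      \<and> \<bar>dist (Y \<omega>) x - dist (Y \<omega>) y\<bar> = dist x y \<and> \<bar>dist (Y \<omega>) p - dist (Y \<omega>) q\<bar> = dist p q"
      using xy pq by (intro AE_conjI medians_AE_aligned)
    then have "\<exists>\<omega>. \<bar>dist (Y \<omega>) x - dist (Y \<omega>) p\<bar> = dist x p \<and> \<bar>dist (Y \<omega>) x - dist (Y \<omega>) q\<bar> = dist x q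
      \<and> \<bar>dist (Y \<omega>) y - dist (Y \<omega>) p\<bar> = dist y p \<and> \<bar>dist (Y \<omega>) y - dist (Y \<omega>) q\<bar> = dist y q
      \<and> \<bar>dist (Y \<omega>) x - dist (Y \<omega>) y\<bar> = dist x y \<and> \<bar>dist (Y \<omega>) p - dist (Y \<omega>) q\<bar> = dist p q"
      by (rule eventually_happens'[OF ae_filter_bot])
    then obtain z where z: "\<bar>dist z x - dist z p\<bar> = dist x p" "\<bar>dist z x - dist z q\<bar> = dist x q"
      "\<bar>dist z y - dist z p\<bar> = dist y p" "\<bar>dist z y - dist z q\<bar> = dist y q"
      "\<bar>dist z x - dist z y\<bar> = dist x y" "\<bar>dist z p - dist z q\<bar> = dist p q"
      by blast
    have sq: "(u - v)\<^sup>2 = w\<^sup>2" if "\<bar>u - v\<bar> = w" for u v w :: real using that by auto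
    \<comment> \<open>After each anchor distance is replaced by a difference of distances to
      \<open>z\<close>, the squares cancel and an expression linear in \<open>dist z x\<close> and
      \<open>dist z y\<close> remains.\<close>
    have "(dist x p)\<^sup>2 - (dist x q)\<^sup>2 - ((dist y p)\<^sup>2 - (dist y q)\<^sup>2)
        = 2 * (dist z q - dist z p) * (dist z x - dist z y)"
      using z(1-4)[THEN sq, symmetric] by (simp add: power2_eq_square algebra_simps)
    then have "\<phi> x - \<phi> y = 2 * ((dist z q - dist z p) * (dist z x - dist z y)) / (2 * dist p q)"
      unfolding \<phi>_def diff_divide_distrib[symmetric] by (simp only: mult.assoc)
    then have "\<bar>\<phi> x - \<phi> y\<bar> = \<bar>dist z p - dist z q\<bar> * \<bar>dist z x - dist z y\<bar> / dist p q"
      by (simp only: mult_divide_mult_cancel_left) (simp add: abs_mult abs_minus_commute)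
    then show ?thesis using z(5,6) pq(3) by simp
  qed
  then show thesis by (rule that)
qed

text \<open>The coordinates of the medians form a complete, bounded, midpoint-convex set of reals,
  hence a closed interval; the inverse of the coordinate is the geodesic.\<close>

lemma medians_segment:
  obtains \<gamma> a b where "a \<le> b" "unit_geodesic \<gamma> {a..b}" "Med = \<gamma> ` {a..b}"
proof -
  obtain \<phi> where iso: "\<And>x y. x \<in> Med \<Longrightarrow> y \<in> Med \<Longrightarrow> \<bar>\<phi> x - \<phi> y\<bar> = dist x y"
    using medians_coordinate by blast
  have comp: "Topological_Spaces.complete (\<phi> ` Med)"
    by (rule isometry_to_real_complete_image[OF medians_complete iso])
  obtain x where x: "x \<in> Med" using medians_nonempty by blast
  obtain e where "\<And>y. y \<in> Med \<Longrightarrow> dist x y \<le> e"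
    using medians_bounded bounded_any_center[of Med x] by blast
  then have bdd: "bounded (\<phi> ` Med)"
    unfolding bounded_def using iso[OF x]
    by (intro exI[of _ "\<phi> x"] exI[of _ e]) (simp add: dist_real_def)
  have "is_interval (\<phi> ` Med)"
  proof (rule closed_midpoint_imp_is_interval)
    show "closed (\<phi> ` Med)" using comp by (rule complete_imp_closed)
    fix u v assume "u \<in> \<phi> ` Med" "v \<in> \<phi> ` Med"
    then obtain p q where pq: "p \<in> Med" "q \<in> Med" "u = \<phi> p" "v = \<phi> q" by blast
    obtain m where m: "CN_midpoint p q m" using hadamard_CN_midpoint[OF H] by blast
    have mM: "m \<in> Med" using medians_midpoint[OF pq(1,2) m] .
    have "\<bar>u - \<phi> m\<bar> = \<bar>u - v\<bar> / 2" "\<bar>v - \<phi> m\<bar> = \<bar>u - v\<bar> / 2"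
      using CN_midpoint_dist[OF m] iso pq mM by simp_all
    then have "\<phi> m = (u + v) / 2" by (auto simp: abs_if field_simps split: if_splits)
    then show "(u + v) / 2 \<in> \<phi> ` Med" using mM by (intro image_eqI[of _ _ m]) simp_all
  qed
  then obtain a b where ab: "\<phi> ` Med = {a..b}"
    using interval_complete_bounded_imp_Icc[OF _ comp bdd] by blast
  have inj: "inj_on \<phi> Med"
  proof (rule inj_onI)
    fix x y assume "x \<in> Med" "y \<in> Med" "\<phi> x = \<phi> y"
    then show "x = y" using iso[of x y] by simp
  qed
  define \<gamma> where "\<gamma> = the_inv_into Med \<phi>"
  have \<gamma>: "\<gamma> t \<in> Med \<and> \<phi> (\<gamma> t) = t" if "t \<in> {a..b}" for t
    unfolding \<gamma>_def
    using that the_inv_into_into[OF inj _ order_refl] f_the_inv_into_f[OF inj] by (simp add: ab)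
  show thesis
  proof (rule that)
    have "\<phi> x \<in> {a..b}" using x ab by blast
    then show "a \<le> b" by simp
    show "unit_geodesic \<gamma> {a..b}"
      unfolding unit_geodesic_def
    proof (intro conjI ballI is_interval_cc)
      fix s t assume "s \<in> {a..b}" "t \<in> {a..b}"
      then show "dist (\<gamma> s) (\<gamma> t) = \<bar>s - t\<bar>" using iso[of "\<gamma> s" "\<gamma> t"] \<gamma> by simp
    qed
    show "Med = \<gamma> ` {a..b}"
      unfolding ab[symmetric] \<gamma>_def using inj by (simp add: the_inv_into_onto)
  qed
qed

section \<open>Probabilities of the two directions and of the interior\<close>

lemma medians_segment_prob:
  assumes g: "unit_geodesic \<gamma> {a..b}" and ab: "a < b" and im: "\<gamma> ` {a..b} = Med"
  shows "measure M {\<omega>\<in>space M. Y \<omega> \<in> Lset \<gamma> {a..b}} = 1/2" (is "measure M ?A = _")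
    and "measure M {\<omega>\<in>space M. Y \<omega> \<in> Rset \<gamma> {a..b}} = 1/2" (is "measure M ?B = _")
    and "measure M {\<omega>\<in>space M. Y \<omega> \<in> \<gamma> ` int_open {a..b}} = 0" (is "measure M ?C = _")
proof -
  have d: "\<And>u v. u \<in> {a..b} \<Longrightarrow> v \<in> {a..b} \<Longrightarrow> dist (\<gamma> u) (\<gamma> v) = \<bar>u - v\<bar>"
    using g unfolding unit_geodesic_def by auto
  have dab: "dist (\<gamma> a) (\<gamma> b) = b - a" using d[of a b] ab by simp
  have A: "?A = {\<omega>\<in>space M. dist (Y \<omega>) (\<gamma> b) - dist (Y \<omega>) (\<gamma> a) = b - a}"
    unfolding Lset_segment_eq[OF H g ab] by simp
  have B: "?B = {\<omega>\<in>space M. dist (Y \<omega>) (\<gamma> a) - dist (Y \<omega>) (\<gamma> b) = b - a}"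
    unfolding Rset_segment_eq[OF H g ab] by simp
  have meas: "?A \<in> sets M" "?B \<in> sets M" unfolding A B by measurable
  have ends: "\<gamma> a \<in> Med" "\<gamma> b \<in> Med" using im ab by auto
  have ae: "AE \<omega> in M. \<bar>dist (Y \<omega>) (\<gamma> a) - dist (Y \<omega>) (\<gamma> b)\<bar> = b - a"
    using medians_AE_aligned[OF ends] dab by simp
  have "AE \<omega> in M. \<omega> \<in> ?A \<union> ?B"
    using ae AE_space by eventually_elim (auto simp: A B abs_if split: if_splits)
  then have AB: "measure M (?A \<union> ?B) = 1"
    using meas by (subst prob_eq_1) auto
  have "?A \<inter> ?B = {}" unfolding A B using ab by auto
  then have sum: "measure M ?A + measure M ?B = 1"
    using AB finite_measure_Union[OF meas] by simp
  \<comment> \<open>Both endpoints are medians. The difference of their objective values is the mean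
    of an integrand almost surely equal to \<open>b - a\<close> on \<open>?A\<close> and to its
    negative on \<open>?B\<close>, so the two events have equal mass.\<close>
  have "0 = F (\<gamma> b) - F (\<gamma> a)" using ends by (auto simp: medians_eq intro: antisym)
  also have "\<dots> = (\<integral>\<omega>. (b - a) * (indicator ?A \<omega> - indicator ?B \<omega>) \<partial>M)"
    unfolding F_diff
  proof (rule integral_cong_AE)
    show "AE \<omega> in M. dist (Y \<omega>) (\<gamma> b) - dist (Y \<omega>) (\<gamma> a) = (b - a) * (indicator ?A \<omega> - indicator ?B \<omega>)"
      using ae AE_space
    proof eventually_elim
      case (elim \<omega>)
      then show ?case unfolding A B using ab by (auto simp: indicator_def abs_if split: if_splits)
    qed
  qed (use meas in simp_all)
  also have "\<dots> = (b - a) * (measure M ?A - measure M ?B)"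
    using meas by (simp add: Bochner_Integration.integral_diff emeasure_eq_measure)
  finally have "measure M ?A = measure M ?B" using ab by simp
  with sum show "measure M ?A = 1/2" "measure M ?B = 1/2" by simp_all
  show "measure M ?C = 0"
  \<comment> \<open>\<open>measure\<close> is 0 by convention outside \<open>sets M\<close>, so only
    the measurable case needs an argument.\<close>
  proof (cases "?C \<in> sets M")
    case True
    have "AE \<omega> in M. \<omega> \<notin> ?C"
      using ae
    proof eventually_elim
      case (elim \<omega>)
      show ?case
      proof
        assume "\<omega> \<in> ?C"
        then obtain t where t: "a < t" "t < b" "Y \<omega> = \<gamma> t"
          unfolding int_open_def int_ominus_def int_oplus_def by force
        \<comment> \<open>At an interior point \<open>\<gamma> t\<close> the distances to the ends
          are \<open>t - a\<close> and \<open>b - t\<close>, whose difference is strictly smaller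
          than \<open>b - a\<close> in absolute value.\<close>
        then show False using elim d[of t a] d[of t b] by (auto simp: abs_if split: if_splits)
      qed
    qed
    then show ?thesis using True prob_eq_0 by blast
  next
    case False
    then show ?thesis by (rule measure_notin_sets)
  qed
qed

end

section \<open>Reduction of an arbitrary parametrization to a compact interval\<close>

theorem mainTheorem3:
  fixes M :: "'w measure" and Y :: "'w \<Rightarrow> 'a::metric_space" and x0 :: 'a
  assumes "hadamard (UNIV :: 'a set)"
    and "prob_space M"
    and "Y \<in> measurable M borel"
  shows "(\<exists>\<gamma> a b. a \<le> b \<and> unit_geodesic \<gamma> {a..b} \<and> frechet_medians M Y x0 = \<gamma> ` {a..b})
    \<and> (\<forall>\<gamma> I. unit_geodesic \<gamma> I \<and> \<gamma> ` I = frechet_medians M Y x0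
          \<and> (\<exists>p q. p \<in> frechet_medians M Y x0 \<and> q \<in> frechet_medians M Y x0 \<and> p \<noteq> q)
        \<longrightarrow> measure M {\<omega>\<in>space M. Y \<omega> \<in> Lset \<gamma> I} = 1/2
          \<and> measure M {\<omega>\<in>space M. Y \<omega> \<in> Rset \<gamma> I} = 1/2
          \<and> measure M {\<omega>\<in>space M. Y \<omega> \<in> \<gamma> ` int_open I} = 0)"
proof (intro conjI allI impI)
  interpret hadamard_random_variable M Y x0
    using assms by (intro hadamard_random_variable.intro hadamard_random_variable_axioms.intro)
  show "\<exists>\<gamma> a b. a \<le> b \<and> unit_geodesic \<gamma> {a..b} \<and> frechet_medians M Y x0 = \<gamma> ` {a..b}"
  proof -
    obtain \<gamma> a b where "a \<le> b" "unit_geodesic \<gamma> {a..b}" "Med = \<gamma> ` {a..b}"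
      by (rule medians_segment)
    then show ?thesis by blast
  qed
  fix \<gamma> I
  assume asm: "unit_geodesic \<gamma> I \<and> \<gamma> ` I = frechet_medians M Y x0
          \<and> (\<exists>p q. p \<in> frechet_medians M Y x0 \<and> q \<in> frechet_medians M Y x0 \<and> p \<noteq> q)"
  then have g: "is_interval I" "\<And>s t. s \<in> I \<Longrightarrow> t \<in> I \<Longrightarrow> dist (\<gamma> s) (\<gamma> t) = \<bar>s - t\<bar>"
    and im: "\<gamma> ` I = Med"
    unfolding unit_geodesic_def by auto
  \<comment> \<open>The inverse of \<open>\<gamma>\<close> is an isometric coordinate on the
    medians. Completeness and boundedness of the medians thus pass to \<open>I\<close>, which must
    be some \<open>{a..b}\<close>; two distinct medians give \<open>a < b\<close>.\<close>
  have "inj_on \<gamma> I" by (rule inj_onI) (metis g(2) dist_self abs_eq_0 eq_iff_diff_eq_0)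
  then have inv: "the_inv_into I \<gamma> (\<gamma> s) = s" if "s \<in> I" for s
    using that by (rule the_inv_into_f_f)
  have "Topological_Spaces.complete (the_inv_into I \<gamma> ` \<gamma> ` I)"
    using medians_complete unfolding im[symmetric]
    by (rule isometry_to_real_complete_image) (auto simp: inv g(2))
  then have "Topological_Spaces.complete I" by (simp add: image_image inv)
  moreover have "bounded I"
  proof -
    obtain c where c: "\<forall>x\<in>\<gamma> ` I. \<forall>y\<in>\<gamma> ` I. dist x y \<le> c"
      using medians_bounded unfolding im bounded_two_points by blast
    have "dist s t \<le> c" if "s \<in> I" "t \<in> I" for s t
    proof -
      have "dist (\<gamma> s) (\<gamma> t) \<le> c" using c that by blast
      then show ?thesis using g(2)[OF that] by (simp add: dist_real_def)
    qed
    then show ?thesis unfolding bounded_two_points by blast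
  qed
  ultimately obtain a b where I: "I = {a..b}"
    using interval_complete_bounded_imp_Icc[OF g(1)] by blast
  have "a < b"
  proof -
    obtain s t where "s \<in> I" "t \<in> I" "s \<noteq> t" using asm by (metis imageE)
    then show ?thesis unfolding I by auto
  qed
  then show "measure M {\<omega>\<in>space M. Y \<omega> \<in> Lset \<gamma> I} = 1/2"
    "measure M {\<omega>\<in>space M. Y \<omega> \<in> Rset \<gamma> I} = 1/2"
    "measure M {\<omega>\<in>space M. Y \<omega> \<in> \<gamma> ` int_open I} = 0"
    using medians_segment_prob[of \<gamma> a b] asm unfolding I by simp_all
qed

end
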